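(* For $0<\alpha<1$ and $\beta\ge 0$ let $$\Phi_{\alpha,\beta}(s)=s^{\alpha}\left(1+(1-\alpha)s^{\alpha-1}\right)^{-\beta},\qquad s>0.$$ For every $0<\alpha<1$ and $\beta\ge 0$, the following are equivalent: (i) $0\le\beta\le 1$; (ii) $\Phi_{\alpha,\beta}$ is a Bernstein function; (iii) $\Phi_{\alpha,\beta}$ is a complete Bernstein function.
   Context: A function $f:(0,\infty)\to[0,\infty)$ is completely monotone if $f\in C^\infty$ and $(-1)^n f^{(n)}(x)\ge 0$ for all $n\ge 0$, $x>0$. A function $g:(0,\infty)\to[0,\infty)$ is a Bernstein function if $g\in C^\infty$ and $g'$ is completely monotone; equivalently, with unique $(a,b,\nu)$, $g(x)=a+bx+\int_{(0,\infty)}(1-e^{-xt})\,\nu(dt)$, where $a,b\ge 0$ and $\nu$ is a positive measure on $(0,\infty)$ (the Lévy measure) with $\int(1\wedge t)\,\nu(dt)<\infty$. A Bernstein function is a complete Bernstein function if its Lévy measure is absolutely continuous with a completely monotone density. *)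

theory Defs
  imports "HOL-Analysis.Analysis"
begin

text \<open>
  Functions on \<open>(0,\<infinity>)\<close> are represented by total functions \<open>real \<Rightarrow> real\<close>. Since \<open>(0,\<infinity>)\<close> is open,
  values at nonpositive arguments do not affect any of the notions below.
\<close>

definition smooth_pos :: "(real \<Rightarrow> real) \<Rightarrow> bool" where
  "smooth_pos f \<longleftrightarrow> (\<forall>n. \<forall>x>0. (deriv ^^ n) f field_differentiable (at x))"

text \<open>Nonnegativity of \<open>f\<close> itself is the case \<open>n = 0\<close>.\<close>

definition completely_monotone :: "(real \<Rightarrow> real) \<Rightarrow> bool" where
  "completely_monotone f \<longleftrightarrow>
     smooth_pos f \<and> (\<forall>n. \<forall>x>0. (-1) ^ n * (deriv ^^ n) f x \<ge> 0)"

definition bernstein_function :: "(real \<Rightarrow> real) \<Rightarrow> bool" where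
  "bernstein_function g \<longleftrightarrow>
     (\<forall>x>0. g x \<ge> 0) \<and> smooth_pos g \<and> completely_monotone (deriv g)"

definition levy_triplet :: "(real \<Rightarrow> real) \<Rightarrow> real \<Rightarrow> real \<Rightarrow> real measure \<Rightarrow> bool" where
  "levy_triplet g a b \<nu> \<longleftrightarrow>
     a \<ge> 0 \<and> b \<ge> 0 \<and>
     space \<nu> = {0<..} \<and> sets \<nu> = sets (restrict_space borel {0<..}) \<and>
     (\<integral>\<^sup>+ t. ennreal (min 1 t) \<partial>\<nu>) < \<infinity> \<and>
     (\<forall>x>0. g x = a + b * x + (\<integral>t. (1 - exp (- x * t)) \<partial>\<nu>))"

text \<open>
  The triplet of a Bernstein function is unique, so the existential quantifier over
  \<open>a\<close>, \<open>b\<close>, \<open>\<nu>\<close> picks out its Levy measure. The density \<open>m\<close> is smooth, hence measurable,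
  on \<open>(0,\<infinity>)\<close>.
\<close>

definition complete_bernstein_function :: "(real \<Rightarrow> real) \<Rightarrow> bool" where
  "complete_bernstein_function g \<longleftrightarrow>
     bernstein_function g \<and>
     (\<exists>a b \<nu> m. levy_triplet g a b \<nu> \<and> completely_monotone m \<and>
        \<nu> = density (restrict_space lborel {0<..}) (\<lambda>t. ennreal (m t)))"

definition Phi :: "real \<Rightarrow> real \<Rightarrow> real \<Rightarrow> real" where
  "Phi \<alpha> \<beta> s = s powr \<alpha> * (1 + (1 - \<alpha>) * s powr (\<alpha> - 1)) powr (- \<beta>)"

end

theory Submission
  imports Defs "HOL-Real_Asymp.Real_Asymp" "HOL-Complex_Analysis.Complex_Analysis"
begin

text \<open>
  Write \<open>\<gamma> = 1 - \<alpha>\<close>, so that \<open>0 < \<gamma> < 1\<close>, and \<open>\<Phi>\<close> for \<^term>\<open>Phi \<alpha> \<beta>\<close>. A complete Bernstein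
  function is a Bernstein function by definition. It remains to see that \<open>\<beta> \<le> 1\<close> makes \<open>\<Phi>\<close> complete
  Bernstein and that \<open>\<beta> > 1\<close> prevents it from being Bernstein.
  
  The second claim is visible at the origin. There \<open>\<Phi> s / s\<close> is of order \<open>s powr (\<gamma> * (\<beta> - 1))\<close>, which tends
  to \<open>0\<close> if \<open>\<beta> > 1\<close>. But a nonnegative concave function with \<open>g s / s\<close> tending to \<open>0\<close> at the origin has
  nonpositive slope everywhere; if it is also nondecreasing, it is zero (\<open>bernstein_function_eq_0\<close>).
  
  For the first claim, the reason is that \<open>\<Phi>\<close> maps the upper half-plane to itself. If \<open>s\<close> has argument
  \<open>\<theta>\<close>, then \<open>1 + \<gamma> * s powr (- \<gamma>)\<close> has an argument between \<open>- \<gamma> * \<theta>\<close> and \<open>0\<close>, and so \<open>\<Phi> s\<close> has an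
  argument between \<open>\<alpha> * \<theta>\<close> and \<open>\<alpha> * \<theta> + \<beta> * \<gamma> * \<theta> \<le> \<theta>\<close>. Only the boundary values on the negative
  axis are needed (\<open>Im_Phi_quot_nonpos\<close>). Cauchy's formula for \<open>\<Phi> s / s\<close> on the slit plane
  (\<open>strip_cauchy_formula\<close>, in the variable \<open>ln s\<close>) turns these boundary values into a nonnegative measure
  \<open>\<sigma>\<close> on the half-line such that \<open>\<Phi> s\<close> is the \<open>\<sigma>\<close>-integral of \<open>s / (s + r)\<close> over \<open>r\<close>. Now
  \<open>s / (s + r)\<close> is the integral of \<open>1 - exp (- s * t)\<close> against the density \<open>r * exp (- t * r)\<close>, and so the
  Levy measure of \<open>\<Phi>\<close> has as its density the \<open>\<sigma>\<close>-integral of \<open>r * exp (- t * r)\<close> over \<open>r\<close>, which is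
  completely monotone (\<open>complete_bernstein_function_stieltjes_integral\<close>).
\<close>

section \<open>Iterated derivatives on the half-line\<close>

text \<open>
  Everything about \<^term>\<open>(deriv ^^ n) f\<close> is reduced to a sequence of explicit candidates \<open>D n\<close>. Only
  arguments \<open>x > 0\<close> are compared: \<open>f\<close> and \<open>D 0\<close> may differ elsewhere, and since the half-line is open
  this does not disturb the derivatives.
\<close>

lemma deriv_funpow_pos:
  assumes D: "\<And>n x. x > 0 \<Longrightarrow> (D n has_real_derivative D (Suc n) x) (at x)"
    and f: "\<And>x. x > 0 \<Longrightarrow> f x = D 0 x" and "x > 0"
  shows "(deriv ^^ n) f x = D n x" and "((deriv ^^ n) f has_real_derivative D (Suc n) x) (at x)"
proof -
  have "(\<forall>x>0. (deriv ^^ n) f x = D n x) \<and>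
        (\<forall>x>0. ((deriv ^^ n) f has_real_derivative D (Suc n) x) (at x))"
  proof (induction n)
    case 0
    have "(f has_real_derivative D (Suc 0) x) (at x)" if "x > 0" for x
      by (rule has_field_derivative_transform_within_open[OF D[OF that], of "{0<..}"])
         (use that f in auto)
    then show ?case using f by simp
  next
    case (Suc n)
    then have eq: "(deriv ^^ Suc n) f x = D (Suc n) x" if "x > 0" for x
      using that by (auto intro: DERIV_imp_deriv)
    have "((deriv ^^ Suc n) f has_real_derivative D (Suc (Suc n)) x) (at x)" if "x > 0" for x
      by (rule has_field_derivative_transform_within_open[OF D[OF that], of "{0<..}"])
         (use that eq in auto)
    with eq show ?case by blast
  qed
  then show "(deriv ^^ n) f x = D n x" and "((deriv ^^ n) f has_real_derivative D (Suc n) x) (at x)"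
    using \<open>x > 0\<close> by blast+
qed

lemma smooth_posI:
  assumes "\<And>n x. x > 0 \<Longrightarrow> (D n has_real_derivative D (Suc n) x) (at x)"
    and "\<And>x. x > 0 \<Longrightarrow> f x = D 0 x"
  shows "smooth_pos f"
  unfolding smooth_pos_def field_differentiable_def
  using deriv_funpow_pos(2)[of D, OF assms] by blast

lemma completely_monotoneI:
  assumes "\<And>n x. x > 0 \<Longrightarrow> (D n has_real_derivative D (Suc n) x) (at x)"
    and "\<And>x. x > 0 \<Longrightarrow> f x = D 0 x"
    and "\<And>n x. x > 0 \<Longrightarrow> 0 \<le> (-1) ^ n * D n x"
  shows "completely_monotone f"
  unfolding completely_monotone_def
  using smooth_posI[of D, OF assms(1,2)] deriv_funpow_pos(1)[of D, OF assms(1,2)] assms(3) by simp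

section \<open>Differentiating Laplace integrals\<close>

lemma exp_remainder_le: "\<bar>exp u - 1 - u\<bar> \<le> u\<^sup>2 * exp \<bar>u\<bar>" for u :: real
proof -
  have "1 - u \<le> exp (- u)" "1 + u \<le> exp u" using exp_ge_add_one_self[of "-u"] exp_ge_add_one_self[of u] by auto
  then have "exp u * (1 - u) \<le> 1"
    by (metis exp_minus_inverse exp_ge_zero mult_left_mono)
  then have *: "exp u - 1 - u \<le> u * (exp u - 1)" by (simp add: algebra_simps)
  have "\<bar>exp u - 1\<bar> \<le> \<bar>u\<bar> * exp \<bar>u\<bar>"
  proof (cases "u \<ge> 0")
    case True
    then show ?thesis using \<open>exp u * (1 - u) \<le> 1\<close> by (simp add: algebra_simps)
  next
    case False
    have "1 - exp u \<le> - u * 1" using \<open>1 + u \<le> exp u\<close> by linarith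
    also have "\<dots> \<le> - u * exp (- u)" using False by (intro mult_left_mono) auto
    finally show ?thesis using False by simp
  qed
  then have "\<bar>u * (exp u - 1)\<bar> \<le> \<bar>u\<bar> * (\<bar>u\<bar> * exp \<bar>u\<bar>)"
    unfolding abs_mult by (intro mult_left_mono) auto
  then have "u * (exp u - 1) \<le> u\<^sup>2 * exp \<bar>u\<bar>"
    by (simp add: power2_eq_square abs_mult[symmetric] mult.assoc[symmetric])
  with * \<open>1 + u \<le> exp u\<close> show ?thesis by linarith
qed

text \<open>
  Half of the exponential decay is spent on absorbing the factor \<open>exp (\<bar>h\<bar> * r)\<close> from the Taylor
  remainder. The bound is therefore uniform in \<open>h\<close> and integrates to a multiple of \<open>h\<^sup>2\<close>, so that
  differentiation under the integral sign becomes a mere estimate.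
\<close>

lemma exp_kernel_remainder_le:
  fixes x h r :: real
  assumes "\<bar>h\<bar> \<le> x / 2" "0 \<le> r"
  shows "\<bar>exp (- (x + h) * r) - exp (- x * r) + h * (r * exp (- x * r))\<bar> \<le> h\<^sup>2 * (r\<^sup>2 * exp (- (x / 2) * r))"
proof -
  have "exp (- (x + h) * r) - exp (- x * r) + h * (r * exp (- x * r))
      = exp (- x * r) * (exp (- h * r) - 1 - (- h * r))"
    by (simp add: exp_add[symmetric] algebra_simps)
  then have "\<bar>exp (- (x + h) * r) - exp (- x * r) + h * (r * exp (- x * r))\<bar>
      = exp (- x * r) * \<bar>exp (- h * r) - 1 - (- h * r)\<bar>"
    by (simp add: abs_mult)
  also have "\<dots> \<le> exp (- x * r) * ((- h * r)\<^sup>2 * exp \<bar>- h * r\<bar>)"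
    by (intro mult_left_mono exp_remainder_le) auto
  also have "\<dots> = h\<^sup>2 * r\<^sup>2 * exp (- x * r + \<bar>h\<bar> * r)"
    unfolding exp_add using assms by (simp add: power_mult_distrib abs_mult)
  also have "\<dots> \<le> h\<^sup>2 * r\<^sup>2 * exp (- (x / 2) * r)"
    using mult_right_mono[OF assms] by (intro mult_left_mono) (auto simp: field_simps)
  finally show ?thesis by (simp add: mult.assoc)
qed

lemma has_real_derivative_quadratic_remainder:
  fixes g :: "real \<Rightarrow> real" and x D C d :: real
  assumes "0 < d" and "\<And>h::real. \<bar>h\<bar> \<le> d \<Longrightarrow> \<bar>g (x + h) - g x - h * D\<bar> \<le> h\<^sup>2 * C"
  shows "(g has_real_derivative D) (at x)"
proof -
  have "((\<lambda>h. (g (x + h) - g x) / h - D) \<longlongrightarrow> 0) (at 0)"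
  proof (rule Lim_null_comparison)
    show "\<forall>\<^sub>F h in at 0. norm ((g (x + h) - g x) / h - D) \<le> \<bar>h\<bar> * C"
      unfolding eventually_at
    proof (intro exI[of _ d] conjI ballI impI)
      fix h :: real assume h: "h \<noteq> 0 \<and> dist h 0 < d"
      have "norm ((g (x + h) - g x) / h - D) = \<bar>g (x + h) - g x - h * D\<bar> / \<bar>h\<bar>"
        using h by (simp add: abs_divide[symmetric] diff_divide_distrib)
      also have "\<dots> \<le> (h\<^sup>2 * C) / \<bar>h\<bar>"
        using h assms(2)[of h] by (intro divide_right_mono) auto
      also have "\<dots> = \<bar>h\<bar> * C"
        using h by (simp add: power2_eq_square field_simps)
      finally show "norm ((g (x + h) - g x) / h - D) \<le> \<bar>h\<bar> * C" .
    qed fact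
    show "((\<lambda>h. \<bar>h\<bar> * C) \<longlongrightarrow> 0) (at 0)" by (auto intro!: tendsto_eq_intros)
  qed
  then show ?thesis unfolding DERIV_def using LIM_zero_iff by blast
qed

text \<open>
  The summand \<open>q\<close> does not depend on \<open>x\<close>, but it can make the integrand integrable where
  \<open>exp (- x * \<phi> v)\<close> alone is not. With \<open>n = 0\<close> and \<open>q = - 1\<close> the lemma covers the Levy integrand
  \<open>1 - exp (- x * \<phi> v)\<close> over an infinite measure, with \<open>q = 0\<close> all its higher derivatives.
\<close>

lemma has_real_derivative_laplace_integral:
  fixes \<phi> q :: "'a \<Rightarrow> real"
  assumes pos: "\<And>v. v \<in> space M \<Longrightarrow> 0 \<le> \<phi> v"
    and int0: "\<And>x. x > 0 \<Longrightarrow> integrable M (\<lambda>v. q v + \<phi> v ^ n * exp (- x * \<phi> v))"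
    and int: "\<And>k x. x > 0 \<Longrightarrow> n < k \<Longrightarrow> integrable M (\<lambda>v. \<phi> v ^ k * exp (- x * \<phi> v))"
    and "x > 0"
  shows "((\<lambda>x. \<integral>v. q v + \<phi> v ^ n * exp (- x * \<phi> v) \<partial>M) has_real_derivative
           - (\<integral>v. \<phi> v ^ Suc n * exp (- x * \<phi> v) \<partial>M)) (at x)"
proof (rule has_real_derivative_quadratic_remainder[of "x / 2"])
  show "0 < x / 2" using \<open>x > 0\<close> by simp
  fix h :: real assume h: "\<bar>h\<bar> \<le> x / 2"
  let ?g = "\<lambda>x v. q v + \<phi> v ^ n * exp (- x * \<phi> v)"
  have i1: "integrable M (?g (x + h))" using h \<open>x > 0\<close> by (intro int0) auto
  note i2 = int0[OF \<open>x > 0\<close>] and i3 = int[OF \<open>x > 0\<close> lessI]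
  have i4: "integrable M (\<lambda>v. \<phi> v ^ (n + 2) * exp (- (x / 2) * \<phi> v))"
    using \<open>x > 0\<close> by (intro int) auto
  have "\<bar>(\<integral>v. ?g (x + h) v \<partial>M) - (\<integral>v. ?g x v \<partial>M) - h * - (\<integral>v. \<phi> v ^ Suc n * exp (- x * \<phi> v) \<partial>M)\<bar>
      = \<bar>\<integral>v. ?g (x + h) v - ?g x v + h * (\<phi> v ^ Suc n * exp (- x * \<phi> v)) \<partial>M\<bar>"
    unfolding Bochner_Integration.integral_add[OF Bochner_Integration.integrable_diff[OF i1 i2]
        integrable_mult_right[OF i3, of h]] Bochner_Integration.integral_diff[OF i1 i2]
      integral_mult_right_zero by simp
  also have "\<dots> \<le> (\<integral>v. \<bar>?g (x + h) v - ?g x v + h * (\<phi> v ^ Suc n * exp (- x * \<phi> v))\<bar> \<partial>M)"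
    by (rule integral_abs_bound)
  also have "\<dots> \<le> (\<integral>v. h\<^sup>2 * (\<phi> v ^ (n + 2) * exp (- (x / 2) * \<phi> v)) \<partial>M)"
  proof (rule integral_mono)
    fix v assume "v \<in> space M"
    have "?g (x + h) v - ?g x v + h * (\<phi> v ^ Suc n * exp (- x * \<phi> v))
        = \<phi> v ^ n * (exp (- (x + h) * \<phi> v) - exp (- x * \<phi> v) + h * (\<phi> v * exp (- x * \<phi> v)))"
      by (simp add: algebra_simps)
    then have "\<bar>?g (x + h) v - ?g x v + h * (\<phi> v ^ Suc n * exp (- x * \<phi> v))\<bar>
        \<le> \<phi> v ^ n * (h\<^sup>2 * ((\<phi> v)\<^sup>2 * exp (- (x / 2) * \<phi> v)))"
      using pos[OF \<open>v \<in> space M\<close>] exp_kernel_remainder_le[OF h pos[OF \<open>v \<in> space M\<close>]]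
      by (simp only: abs_mult) (intro mult_mono, auto)
    then show "\<bar>?g (x + h) v - ?g x v + h * (\<phi> v ^ Suc n * exp (- x * \<phi> v))\<bar>
        \<le> h\<^sup>2 * (\<phi> v ^ (n + 2) * exp (- (x / 2) * \<phi> v))"
      by (simp add: power_add power2_eq_square mult_ac)
  qed (intro integrable_abs Bochner_Integration.integrable_add Bochner_Integration.integrable_diff
      integrable_mult_right i1 i2 i3 i4)+
  finally show "\<bar>(\<integral>v. ?g (x + h) v \<partial>M) - (\<integral>v. ?g x v \<partial>M) - h * - (\<integral>v. \<phi> v ^ Suc n * exp (- x * \<phi> v) \<partial>M)\<bar>
      \<le> h\<^sup>2 * (\<integral>v. \<phi> v ^ (n + 2) * exp (- (x / 2) * \<phi> v) \<partial>M)"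
    by simp
qed

text \<open>
  Each differentiation multiplies the integrand by \<open>- \<phi> v\<close>, so the signs alternate. The factor
  \<open>\<phi> v\<close> in front of the exponential is present in both later uses: in the derivative of a Levy
  integral, and in the Levy density belonging to a mixture of functions \<open>x / (x + r)\<close>.
\<close>

lemma completely_monotone_laplace_integral:
  fixes \<phi> :: "'a \<Rightarrow> real"
  assumes pos: "\<And>v. v \<in> space M \<Longrightarrow> 0 \<le> \<phi> v"
    and int: "\<And>k x. x > 0 \<Longrightarrow> k > 0 \<Longrightarrow> integrable M (\<lambda>v. \<phi> v ^ k * exp (- x * \<phi> v))"
    and f: "\<And>x. x > 0 \<Longrightarrow> f x = (\<integral>v. \<phi> v * exp (- x * \<phi> v) \<partial>M)"
  shows "completely_monotone f"
proof (rule completely_monotoneI)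
  let ?D = "\<lambda>n x. (- 1) ^ n * (\<integral>v. \<phi> v ^ Suc n * exp (- x * \<phi> v) \<partial>M)"
  show "(?D n has_real_derivative ?D (Suc n) x) (at x)" if "x > 0" for n and x :: real
  proof -
    have "((\<lambda>x. \<integral>v. 0 + \<phi> v ^ Suc n * exp (- x * \<phi> v) \<partial>M) has_real_derivative
        - (\<integral>v. \<phi> v ^ Suc (Suc n) * exp (- x * \<phi> v) \<partial>M)) (at x)"
      by (rule has_real_derivative_laplace_integral[OF pos _ _ that])
         (use int in \<open>simp_all del: power_Suc\<close>)
    from DERIV_cmult[OF this, of "(-1) ^ n"] show ?thesis by simp
  qed
  show "f x = ?D 0 x" if "x > 0" for x using f[OF that] by simp
  show "0 \<le> (- 1) ^ n * ?D n x" for n x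
    by (auto simp: mult.assoc[symmetric] power_add[symmetric] mult_2[symmetric] intro!: integral_nonneg_AE AE_I2 mult_nonneg_nonneg zero_le_power pos)
qed

text \<open>
  All Laplace kernels are dominated by \<open>1 / (1 + r)\<close>. One integrability condition, on the Stieltjes
  kernel at \<open>x = 1\<close>, thus controls all powers and all \<open>x > 0\<close> at once.
\<close>

lemma power_exp_le_div:
  fixes x :: real
  assumes "x > 0"
  obtains C where "0 \<le> C" "\<And>r. 0 \<le> r \<Longrightarrow> r ^ k * exp (- x * r) \<le> C / (1 + r)"
proof
  let ?C = "fact k / x ^ k + fact (Suc k) / x ^ Suc k"
  show "0 \<le> ?C" using assms by (intro add_nonneg_nonneg divide_nonneg_nonneg) auto
  fix r :: real assume r: "0 \<le> r"
  have *: "r ^ j * exp (- x * r) \<le> fact j / x ^ j" for j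
  proof -
    have "(x * r) ^ j / fact j \<le> exp (x * r)"
      using sum_le_suminf[of "\<lambda>n. (x * r) ^ n /\<^sub>R fact n" "{j}"] exp_converges[of "x * r"] r assms
      by (simp add: sums_iff divide_inverse_commute)
    then show ?thesis using assms by (simp add: field_simps exp_minus power_mult_distrib)
  qed
  have "r ^ k * exp (- x * r) * (1 + r) = r ^ k * exp (- x * r) + r ^ Suc k * exp (- x * r)"
    by (simp add: algebra_simps)
  also have "\<dots> \<le> ?C" using *[of k] *[of "Suc k"] by linarith
  finally show "r ^ k * exp (- x * r) \<le> ?C / (1 + r)" using r by (simp add: pos_le_divide_eq)
qed

section \<open>Bernstein functions from integral representations\<close>

lemma one_minus_exp_ge: "r / (1 + r) \<le> 1 - exp (- r)" if "0 \<le> r" for r :: real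
proof -
  have "exp (- r) \<le> 1 / (1 + r)"
    using that exp_ge_add_one_self[of r] by (simp add: exp_minus field_simps)
  then show ?thesis using that by (simp add: field_simps)
qed

lemma smooth_pos_if_smooth_pos_deriv:
  assumes "smooth_pos (deriv g)" and "\<And>x. x > 0 \<Longrightarrow> g field_differentiable (at x)"
  shows "smooth_pos g"
  unfolding smooth_pos_def
proof (intro allI impI)
  fix n and x :: real assume "x > 0"
  then show "(deriv ^^ n) g field_differentiable (at x)"
  proof (cases n)
    case (Suc k)
    have "(deriv ^^ n) g = (deriv ^^ k) (deriv g)" unfolding Suc by (simp add: funpow_swap1)
    then show ?thesis using assms(1) \<open>x > 0\<close> by (simp add: smooth_pos_def)
  qed (use assms(2) in simp)
qed

text \<open>
  This is the easy half of the Levy-Khintchine representation. By \<open>one_minus_exp_ge\<close> the kernel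
  \<open>1 - exp (- r)\<close> dominates \<open>r / (1 + r)\<close>, and hence \<open>r ^ k * exp (- x * r)\<close> for every \<open>k > 0\<close>. The
  derivative of \<open>g\<close> is therefore a Laplace integral, which is completely monotone.
\<close>

lemma bernstein_function_levy_integral:
  fixes \<phi> :: "'a \<Rightarrow> real"
  assumes meas: "\<phi> \<in> borel_measurable M"
    and pos: "\<And>v. v \<in> space M \<Longrightarrow> 0 \<le> \<phi> v"
    and int: "\<And>x. x > 0 \<Longrightarrow> integrable M (\<lambda>v. 1 - exp (- x * \<phi> v))"
    and g: "\<And>x. x > 0 \<Longrightarrow> g x = (\<integral>v. 1 - exp (- x * \<phi> v) \<partial>M)"
  shows "bernstein_function g"
proof -
  have int_pow: "integrable M (\<lambda>v. \<phi> v ^ k * exp (- x * \<phi> v))" if "x > 0" "k > 0" for k x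
  proof -
    obtain j where j: "k = Suc j" using \<open>k > 0\<close> gr0_implies_Suc by blast
    obtain C where C: "0 \<le> C" "\<And>r. 0 \<le> r \<Longrightarrow> r ^ j * exp (- x * r) \<le> C / (1 + r)"
      using power_exp_le_div[OF \<open>x > 0\<close>] by blast
    show ?thesis
    proof (rule Bochner_Integration.integrable_bound)
      show "integrable M (\<lambda>v. C * (1 - exp (- 1 * \<phi> v)))" by (intro integrable_mult_right int) simp
      show "(\<lambda>v. \<phi> v ^ k * exp (- x * \<phi> v)) \<in> borel_measurable M" using meas by measurable
      show "AE v in M. norm (\<phi> v ^ k * exp (- x * \<phi> v)) \<le> norm (C * (1 - exp (- 1 * \<phi> v)))"
      proof (rule AE_I2)
        fix v assume "v \<in> space M"
        then have p: "0 \<le> \<phi> v" by (rule pos)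
        have "\<phi> v ^ k * exp (- x * \<phi> v) \<le> \<phi> v * (C / (1 + \<phi> v))"
          using mult_left_mono[OF C(2)[OF p] p] by (simp add: j mult.assoc)
        also have "\<dots> \<le> C * (1 - exp (- 1 * \<phi> v))"
          using mult_left_mono[OF one_minus_exp_ge[OF p] C(1)] by (simp add: mult.commute)
        finally have le: "\<phi> v ^ k * exp (- x * \<phi> v) \<le> C * (1 - exp (- 1 * \<phi> v))" .
        have "0 \<le> \<phi> v ^ k * exp (- x * \<phi> v)" using p by simp
        with le order.trans[OF this le]
        show "norm (\<phi> v ^ k * exp (- x * \<phi> v)) \<le> norm (C * (1 - exp (- 1 * \<phi> v)))"
          by (simp only: real_norm_def abs_of_nonneg)
      qed
    qed
  qed
  have der: "(g has_real_derivative (\<integral>v. \<phi> v * exp (- x * \<phi> v) \<partial>M)) (at x)" if "x > 0" for x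
  proof -
    have "((\<lambda>x. \<integral>v. - 1 + \<phi> v ^ 0 * exp (- x * \<phi> v) \<partial>M) has_real_derivative
        - (\<integral>v. \<phi> v ^ Suc 0 * exp (- x * \<phi> v) \<partial>M)) (at x)"
    proof (rule has_real_derivative_laplace_integral[OF pos _ _ that])
      show "integrable M (\<lambda>v. - 1 + \<phi> v ^ 0 * exp (- y * \<phi> v))" if "y > 0" for y
        using Bochner_Integration.integrable_minus[OF int[OF that]] by simp
    qed (use int_pow in auto)
    from DERIV_minus[OF this]
    have *: "((\<lambda>x. - (\<integral>v. - 1 + exp (- x * \<phi> v) \<partial>M)) has_real_derivative
        (\<integral>v. \<phi> v * exp (- x * \<phi> v) \<partial>M)) (at x)" by simp
    show ?thesis
    proof (rule has_field_derivative_transform_within_open[OF *, of "{0<..}"])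
      show "- (\<integral>v. - 1 + exp (- y * \<phi> v) \<partial>M) = g y" if "y \<in> {0<..}" for y
        using that g[of y] Bochner_Integration.integral_minus[of M "\<lambda>v. - 1 + exp (- y * \<phi> v)"]
        by simp
    qed (use that in auto)
  qed
  have cm: "completely_monotone (deriv g)"
    by (rule completely_monotone_laplace_integral[OF pos int_pow])
       (assumption | rule DERIV_imp_deriv[OF der])+
  have "0 \<le> g x" if "x > 0" for x
    unfolding g[OF that] using pos that by (intro integral_nonneg_AE AE_I2) simp
  moreover have "smooth_pos g"
  proof (rule smooth_pos_if_smooth_pos_deriv)
    show "smooth_pos (deriv g)" using cm by (simp add: completely_monotone_def)
    show "g field_differentiable at x" if "x > 0" for x
      using der[OF that] field_differentiable_def by blast
  qed
  ultimately show ?thesis unfolding bernstein_function_def using cm by blast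
qed

text \<open>
  The Levy representation of the elementary complete Bernstein function \<open>x / (x + r)\<close>: its Levy density
  is \<open>r * exp (- t * r)\<close>.
\<close>

lemma nn_integral_levy_kernel:
  fixes x r :: real
  assumes "x > 0" "r > 0"
  shows "(\<integral>\<^sup>+t. ennreal (r * exp (- t * r) * (1 - exp (- x * t))) * indicator {0..} t \<partial>lborel)
       = ennreal (x / (x + r))"
proof -
  let ?F = "\<lambda>t. - exp (- t * r) + r / (x + r) * exp (- t * (x + r))"
  have "(\<integral>\<^sup>+t. ennreal (r * exp (- t * r) * (1 - exp (- x * t))) * indicator {0..} t \<partial>lborel)
      = ennreal (0 - ?F 0)"
  proof (rule nn_integral_FTC_atLeast)
    show "(?F has_real_derivative r * exp (- t * r) * (1 - exp (- x * t))) (at t)" for t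
    proof -
      have "(?F has_real_derivative r * exp (- t * r) + r / (x + r) * (exp (- t * (x + r)) * (- (x + r)))) (at t)"
        by (rule derivative_eq_intros refl | simp)+
      moreover have "r / (x + r) * (exp (- t * (x + r)) * (- (x + r))) = - r * exp (- t * (x + r))"
        using assms by (simp add: divide_simps) (simp add: algebra_simps)
      moreover have "exp (- t * (x + r)) = exp (- t * r) * exp (- x * t)"
        by (simp only: exp_add[symmetric]) (simp add: algebra_simps)
      ultimately show ?thesis by (simp only: right_diff_distrib) (simp add: mult.assoc)
    qed
    have "((\<lambda>t. exp (- t * q)) \<longlongrightarrow> 0) at_top" if "q > 0" for q :: real
      using that by real_asymp
    from tendsto_add[OF tendsto_minus[OF this] tendsto_mult_left[OF this], of r "x + r" "r / (x + r)"]
    show "(?F \<longlongrightarrow> 0) at_top" using assms by simp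
  qed (use assms in auto)
  also have "0 - ?F 0 = x / (x + r)" using assms by (simp add: field_simps)
  finally show ?thesis .
qed

text \<open>
  Mixtures of the functions \<open>x / (x + r)\<close>, with \<open>r > 0\<close>, are complete Bernstein functions: by Tonelli
  the Levy densities \<open>r * exp (- t * r)\<close> are mixed in the same way, and mixtures of exponentials are
  completely monotone. The positions \<open>r = \<phi> v\<close> are parametrised by an arbitrary \<open>\<sigma>\<close>-finite space, so
  that the logarithmic variable \<open>r = exp v\<close> can be used below.
\<close>

theorem complete_bernstein_function_stieltjes_integral:
  fixes \<phi> :: "'a \<Rightarrow> real"
  assumes "sigma_finite_measure M"
    and meas [measurable]: "\<phi> \<in> borel_measurable M"
    and pos: "\<And>v. v \<in> space M \<Longrightarrow> 0 < \<phi> v"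
    and g: "\<And>x. x > 0 \<Longrightarrow> has_bochner_integral M (\<lambda>v. x / (x + \<phi> v)) (g x)"
  shows "complete_bernstein_function g"
proof -
  interpret M: sigma_finite_measure M by fact
  interpret P: pair_sigma_finite lborel M ..
  define m where "m t = (\<integral>v. \<phi> v * exp (- t * \<phi> v) \<partial>M)" for t
  define \<nu> where "\<nu> = density (restrict_space lborel {0<..}) (\<lambda>t. ennreal (m t))"
  have int_pow: "integrable M (\<lambda>v. \<phi> v ^ k * exp (- t * \<phi> v))" if "t > 0" for k t
  proof -
    obtain C where C: "0 \<le> C" "\<And>r. 0 \<le> r \<Longrightarrow> r ^ k * exp (- t * r) \<le> C / (1 + r)"
      using power_exp_le_div[OF \<open>t > 0\<close>] by blast
    show ?thesis
    proof (rule Bochner_Integration.integrable_bound)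
      show "integrable M (\<lambda>v. C * (1 / (1 + \<phi> v)))"
        using g[of 1] by (intro integrable_mult_right) (auto simp: has_bochner_integral_iff)
      show "AE v in M. norm (\<phi> v ^ k * exp (- t * \<phi> v)) \<le> norm (C * (1 / (1 + \<phi> v)))"
        using C pos by (intro AE_I2) (auto simp: abs_mult less_imp_le)
    qed measurable
  qed
  have cm: "completely_monotone m"
    by (rule completely_monotone_laplace_integral[OF less_imp_le[OF pos] int_pow]) (auto simp: m_def)
  have [measurable]: "m \<in> borel_measurable borel"
    unfolding m_def by measurable
  have m_nn: "ennreal (m t) = (\<integral>\<^sup>+v. ennreal (\<phi> v * exp (- t * \<phi> v)) \<partial>M)" if "t > 0" for t
    unfolding m_def using int_pow[OF that, of 1] pos
    by (intro nn_integral_eq_integral[symmetric] AE_I2) (auto simp: less_imp_le)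
  have space: "space \<nu> = {0<..}" and sets: "sets \<nu> = sets (restrict_space borel {0<..})"
    by (auto simp: \<nu>_def space_restrict_space sets_restrict_space)
  have nu_meas: "f \<in> borel_measurable \<nu>" if "f \<in> borel_measurable borel" for f :: "real \<Rightarrow> real"
    using measurable_restrict_space1[OF that] unfolding measurable_cong_sets[OF sets refl] .
  have nn: "(\<integral>\<^sup>+t. ennreal (1 - exp (- x * t)) \<partial>\<nu>) = ennreal (g x)" if "x > 0" for x
  proof -
    have "(\<integral>\<^sup>+t. ennreal (1 - exp (- x * t)) \<partial>\<nu>)
        = (\<integral>\<^sup>+t. ennreal (m t) * ennreal (1 - exp (- x * t)) \<partial>restrict_space lborel {0<..})"
      unfolding \<nu>_def by (rule nn_integral_density) (auto intro: measurable_restrict_space1)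
    also have "\<dots> = (\<integral>\<^sup>+t. ennreal (m t) * ennreal (1 - exp (- x * t)) * indicator {0<..} t \<partial>lborel)"
      by (rule nn_integral_restrict_space) simp
    \<comment> \<open>The two half-lines differ only in \<open>t = 0\<close>, where the integrand vanishes; the closed one suits the fundamental theorem of calculus.\<close>
    also have "\<dots> = (\<integral>\<^sup>+t. \<integral>\<^sup>+v. ennreal (\<phi> v * exp (- t * \<phi> v) * (1 - exp (- x * t))) * indicator {0..} t \<partial>M \<partial>lborel)"
    proof (rule nn_integral_cong)
      fix t :: real
      consider "t > 0" | "t = 0" | "t < 0" by linarith
      then show "ennreal (m t) * ennreal (1 - exp (- x * t)) * indicator {0<..} t
          = (\<integral>\<^sup>+v. ennreal (\<phi> v * exp (- t * \<phi> v) * (1 - exp (- x * t))) * indicator {0..} t \<partial>M)"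
      proof cases
        case 1
        have "(\<integral>\<^sup>+v. ennreal (\<phi> v * exp (- t * \<phi> v) * (1 - exp (- x * t))) * indicator {0..} t \<partial>M)
            = (\<integral>\<^sup>+v. ennreal (\<phi> v * exp (- t * \<phi> v)) * ennreal (1 - exp (- x * t)) \<partial>M)"
          using 1 pos \<open>x > 0\<close> by (intro nn_integral_cong) (auto simp: ennreal_mult less_imp_le)
        also have "\<dots> = ennreal (m t) * ennreal (1 - exp (- x * t))"
          by (subst nn_integral_multc) (auto simp: m_nn[OF 1])
        finally show ?thesis using 1 by simp
      qed auto
    qed
    also have "\<dots> = (\<integral>\<^sup>+v. \<integral>\<^sup>+t. ennreal (\<phi> v * exp (- t * \<phi> v) * (1 - exp (- x * t))) * indicator {0..} t \<partial>lborel \<partial>M)"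
      by (rule P.Fubini'[symmetric]) measurable
    also have "\<dots> = (\<integral>\<^sup>+v. ennreal (x / (x + \<phi> v)) \<partial>M)"
      using pos that by (intro nn_integral_cong nn_integral_levy_kernel)
    also have "\<dots> = ennreal (g x)"
      using g[OF that] pos that
      by (subst nn_integral_eq_integral) (auto simp: has_bochner_integral_iff add_pos_pos less_imp_le intro!: AE_I2)
    finally show ?thesis .
  qed
  have g0: "0 \<le> g x" if "x > 0" for x
  proof -
    have "0 \<le> (\<integral>v. x / (x + \<phi> v) \<partial>M)"
      using pos that by (intro integral_nonneg_AE AE_I2) (auto simp: less_imp_le add_pos_pos)
    then show ?thesis using g[OF that] by (simp add: has_bochner_integral_iff)
  qed
  have int: "integrable \<nu> (\<lambda>t. 1 - exp (- x * t)) \<and> (\<integral>t. 1 - exp (- x * t) \<partial>\<nu>) = g x" if "x > 0" for x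
  proof -
    have "(\<lambda>t. 1 - exp (- x * t)) \<in> borel_measurable \<nu>" by (rule nu_meas) measurable
    moreover have "AE t in \<nu>. 0 \<le> 1 - exp (- x * t)"
      using that by (intro AE_I2) (simp add: space)
    ultimately show ?thesis
      using nn_integral_eq_integrable[OF _ _ g0[OF that]] nn[OF that] by blast
  qed
  have "bernstein_function g"
  proof (rule bernstein_function_levy_integral[where \<phi> = "\<lambda>t. t" and M = \<nu>])
    show "(\<lambda>t. t) \<in> borel_measurable \<nu>" by (rule nu_meas) simp
    show "0 \<le> v" if "v \<in> space \<nu>" for v using that by (simp add: space)
  qed (use int in auto)
  moreover have "levy_triplet g 0 0 \<nu>"
  proof -
    have "(\<integral>\<^sup>+t. ennreal (min 1 t) \<partial>\<nu>) \<le> (\<integral>\<^sup>+t. ennreal 2 * ennreal (1 - exp (- 1 * t)) \<partial>\<nu>)"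
    proof (rule nn_integral_mono)
      fix t assume "t \<in> space \<nu>"
      then have "t > 0" by (simp add: space)
      then have "min 1 t \<le> 2 * (t / (1 + t))" by (auto simp: min_def field_simps)
      also have "\<dots> \<le> 2 * (1 - exp (- 1 * t))"
        using one_minus_exp_ge[of t] \<open>t > 0\<close> by simp
      finally show "ennreal (min 1 t) \<le> ennreal 2 * ennreal (1 - exp (- 1 * t))"
        by (metis ennreal_leI ennreal_mult' zero_le_numeral)
    qed
    also have "\<dots> = ennreal 2 * ennreal (g 1)"
    proof (subst nn_integral_cmult)
      show "(\<lambda>t. ennreal (1 - exp (- 1 * t))) \<in> borel_measurable \<nu>"
        by (rule measurable_compose[OF nu_meas measurable_ennreal]) measurable
    qed (simp only: nn zero_less_one)
    also have "\<dots> < \<infinity>" by (simp add: ennreal_mult_less_top)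
    finally show ?thesis
      unfolding levy_triplet_def using int by (simp add: space sets)
  qed
  ultimately show ?thesis
    unfolding complete_bernstein_function_def using cm \<nu>_def by blast
qed

section \<open>Failure of the Bernstein property beyond exponent one\<close>

text \<open>
  A Bernstein function is concave and nonnegative, so it cannot vanish faster than linearly at \<open>0\<close>
  unless it is zero: by the mean value theorem on \<open>[y / 2, y]\<close> and since \<open>deriv g\<close> decreases,
  \<open>deriv g y \<le> 2 * (g y / y)\<close>. As \<open>y\<close> tends to \<open>0\<close>, the monotone derivative is forced to be
  nonpositive everywhere.
\<close>

lemma bernstein_function_eq_0:
  assumes "bernstein_function g" and lim: "((\<lambda>x. g x / x) \<longlongrightarrow> 0) (at_right 0)" and "x > 0"
  shows "g x = 0"
proof -
  have g0: "0 \<le> g y" if "y > 0" for y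
    using assms(1) that by (simp add: bernstein_function_def)
  have cm: "completely_monotone (deriv g)" and sm: "smooth_pos g"
    using assms(1) by (auto simp: bernstein_function_def)
  have der: "(g has_real_derivative deriv g y) (at y)" if "y > 0" for y
    using sm that unfolding smooth_pos_def
    by (metis DERIV_imp_deriv field_differentiable_def funpow_0)
  have der2: "(deriv g has_real_derivative deriv (deriv g) y) (at y)" if "y > 0" for y
    using cm that unfolding smooth_pos_def completely_monotone_def
    by (metis DERIV_imp_deriv field_differentiable_def funpow_0)
  have d2: "deriv (deriv g) y \<le> 0" if "y > 0" for y
  proof -
    have "(- 1) ^ 1 * (deriv ^^ 1) (deriv g) y \<ge> 0"
      using cm that unfolding completely_monotone_def by blast
    then show ?thesis by simp
  qed
  have anti: "deriv g z \<le> deriv g y" if "0 < y" "y \<le> z" for y z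
    by (rule DERIV_nonpos_imp_nonincreasing[OF that(2)]) (meson that der2 d2 order.strict_trans2)
  have bound: "deriv g y \<le> 2 * (g y / y)" if "y > 0" for y
  proof -
    have "\<exists>z. y / 2 < z \<and> z < y \<and> g y - g (y / 2) = (y - y / 2) * deriv g z"
      using that by (intro MVT2) (auto intro!: der)
    then obtain z where z: "y / 2 < z" "z < y" "g y - g (y / 2) = (y / 2) * deriv g z" by auto
    have "(y / 2) * deriv g y \<le> (y / 2) * deriv g z"
      using that z by (intro mult_left_mono anti) auto
    also have "\<dots> \<le> g y" using g0[of "y / 2"] that z by simp
    finally show ?thesis using that by (simp add: field_simps)
  qed
  have "deriv g y \<le> 0" if "y > 0" for y
  proof (rule tendsto_lowerbound)
    show "((\<lambda>e. 2 * (g e / e)) \<longlongrightarrow> 0) (at_right 0)" using tendsto_mult_left[OF lim, of 2] by simp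
    show "\<forall>\<^sub>F e in at_right 0. deriv g y \<le> 2 * (g e / e)"
      using eventually_at_right_real[OF that]
    proof eventually_elim
      case (elim e)
      then show ?case using anti[of e y] bound[of e] by simp
    qed
  qed simp
  then have dec: "g x \<le> g e" if "0 < e" "e \<le> x" for e
    by (intro DERIV_nonpos_imp_nonincreasing[OF that(2)]) (meson that der \<open>\<And>y. y > 0 \<Longrightarrow> deriv g y \<le> 0\<close> order.strict_trans2)
  have "g x \<le> 0"
  proof (rule tendsto_lowerbound)
    show "((\<lambda>e. g e / e * e) \<longlongrightarrow> 0) (at_right 0)"
      using tendsto_mult[OF lim, of "\<lambda>e. e" 0] by (simp add: tendsto_ident_at)
    show "\<forall>\<^sub>F e in at_right 0. g x \<le> g e / e * e"
      using eventually_at_right_real[OF \<open>x > 0\<close>] by eventually_elim (use dec in auto)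
  qed simp
  with g0[OF \<open>x > 0\<close>] show ?thesis by simp
qed

text \<open>
  Near \<open>0\<close> the summand \<open>1\<close> in the base is negligible and \<open>\<Phi> s / s\<close> behaves like a constant times
  \<open>s powr ((1 - \<alpha>) * (\<beta> - 1))\<close>. For an upper bound the summand may simply be dropped.
\<close>

lemma Phi_div_tendsto_0:
  assumes "0 < \<alpha>" "\<alpha> < 1" "1 < \<beta>"
  shows "((\<lambda>s. Phi \<alpha> \<beta> s / s) \<longlongrightarrow> 0) (at_right 0)"
proof (rule Lim_null_comparison)
  show "\<forall>\<^sub>F s in at_right 0. norm (Phi \<alpha> \<beta> s / s) \<le> (1 - \<alpha>) powr (- \<beta>) * s powr ((1 - \<alpha>) * (\<beta> - 1))"
    unfolding eventually_at_right_field
  proof (intro exI[of _ 1] conjI allI impI)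
    fix s :: real assume s: "0 < s" "s < 1"
    have "Phi \<alpha> \<beta> s / s \<le> s powr \<alpha> * ((1 - \<alpha>) * s powr (\<alpha> - 1)) powr (- \<beta>) / s"
      unfolding Phi_def using s assms
      by (intro divide_right_mono mult_left_mono powr_mono2') auto
    also have "\<dots> = (1 - \<alpha>) powr (- \<beta>) * (s powr \<alpha> * s powr ((\<alpha> - 1) * (- \<beta>)) / s)"
      using s assms by (simp only: powr_mult powr_powr) simp
    also have "s powr \<alpha> * s powr ((\<alpha> - 1) * (- \<beta>)) / s = s powr (\<alpha> + (\<alpha> - 1) * (- \<beta>) - 1)"
      using s by (simp only: powr_diff powr_add) simp
    also have "\<alpha> + (\<alpha> - 1) * (- \<beta>) - 1 = (1 - \<alpha>) * (\<beta> - 1)" by (simp add: algebra_simps)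
    finally show "norm (Phi \<alpha> \<beta> s / s) \<le> (1 - \<alpha>) powr (- \<beta>) * s powr ((1 - \<alpha>) * (\<beta> - 1))"
      using s by (simp add: Phi_def)
  qed simp
  have "((\<lambda>s. s powr ((1 - \<alpha>) * (\<beta> - 1))) \<longlongrightarrow> 0) (at_right 0)"
    using assms eventually_at_right_less[of "0 :: real"]
    by (intro tendsto_zero_powrI[OF tendsto_ident_at tendsto_const]) (auto elim: eventually_mono)
  then show "((\<lambda>s. (1 - \<alpha>) powr (- \<beta>) * s powr ((1 - \<alpha>) * (\<beta> - 1))) \<longlongrightarrow> 0) (at_right 0)"
    by (rule tendsto_mult_right_zero)
qed

lemma not_bernstein_Phi:
  assumes "0 < \<alpha>" "\<alpha> < 1" "1 < \<beta>"
  shows "\<not> bernstein_function (Phi \<alpha> \<beta>)"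
proof
  assume "bernstein_function (Phi \<alpha> \<beta>)"
  then have "Phi \<alpha> \<beta> 1 = 0"
    by (rule bernstein_function_eq_0) (use Phi_div_tendsto_0[OF assms] in auto)
  then show False using assms by (simp add: Phi_def)
qed

section \<open>A Cauchy formula on a horizontal strip\<close>

lemma contour_integral_linepath_same_Im:
  assumes "a < b"
  shows "contour_integral (linepath (Complex a c) (Complex b c)) f = integral {a..b} (\<lambda>x. f (Complex x c))"
proof -
  have *: "linepath (Complex a c) (Complex b c) t = Complex ((b - a) *\<^sub>R t + a) c" for t
    by (simp add: linepath_def complex_eq_iff algebra_simps)
  have dif: "Complex b c - Complex a c = of_real (b - a)" by (simp add: complex_eq_iff)
  have iff: "(f has_contour_integral I) (linepath (Complex a c) (Complex b c))
      \<longleftrightarrow> ((\<lambda>x. f (Complex x c)) has_integral I) {a..b}" for I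
  proof -
    have "(f has_contour_integral I) (linepath (Complex a c) (Complex b c))
        \<longleftrightarrow> ((\<lambda>t. (b - a) *\<^sub>R f (Complex ((b - a) *\<^sub>R t + a) c)) has_integral I) {0..1}"
      unfolding has_contour_integral_linepath * dif by (simp only: scaleR_conv_of_real mult.commute)
    also have "\<dots> \<longleftrightarrow> ((\<lambda>t. f (Complex ((b - a) *\<^sub>R t + a) c)) has_integral I /\<^sub>R (b - a)) {0..1}"
      using assms by (intro has_integral_cmul_iff') simp
    also have "\<dots> \<longleftrightarrow> ((\<lambda>x. f (Complex x c)) has_integral I) {a..b}"
      using has_integral_affinity_iff[of "b - a" "\<lambda>x. f (Complex x c)" a I a b] assms by simp
    finally show ?thesis .
  qed
  show ?thesis
    unfolding contour_integral_def integral_def iff contour_integrable_on_def integrable_on_def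
    by simp
qed

text \<open>
  In the logarithmic variable \<open>s = exp z\<close> the plane slit along the negative axis is the strip
  \<open>\<bar>Im z\<bar> < pi\<close>, and the two sides of the slit are its two boundary lines. So a Stieltjes
  representation, usually obtained from a keyhole contour, only takes the rectangle with corners
  \<open>\<plusminus> R \<plusminus> \<i> pi\<close>. The kernel \<open>exp z / (exp z - exp w)\<close> has one pole in it, at \<open>w\<close>, with residue \<open>1\<close>. On
  the horizontal sides \<open>exp z = - exp x\<close>, and the values of \<open>F\<close> are conjugate to each other, so that
  together they give \<open>- 2 \<i>\<close> times the integral of the imaginary part. The vertical sides disappear in
  the limit: on the right the kernel tends to \<open>1\<close>, and on the left it decays like \<open>exp z\<close>, so the
  decay required of \<open>F\<close> is weaker there.
\<close>

lemma strip_cauchy_formula: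
  fixes F :: "complex \<Rightarrow> complex" and w b :: real
  assumes "pi < b" and holo: "F holomorphic_on {z. \<bar>Im z\<bar> < b}"
    and cnj: "\<And>z. \<bar>Im z\<bar> < b \<Longrightarrow> F (cnj z) = cnj (F z)"
    and right: "(Br \<longlongrightarrow> 0) at_top" "\<forall>\<^sub>F R in at_top. \<forall>z. Re z = R \<and> \<bar>Im z\<bar> \<le> pi \<longrightarrow> norm (F z) \<le> Br R"
    and left: "(Bl \<longlongrightarrow> 0) at_top" "\<forall>\<^sub>F R in at_top. \<forall>z. Re z = - R \<and> \<bar>Im z\<bar> \<le> pi \<longrightarrow> norm (F z * exp z) \<le> Bl R"
  shows "((\<lambda>R. integral {-R..R} (\<lambda>x. - Im (F (Complex x pi)) / pi * (exp x / (exp x + exp w)))) \<longlongrightarrow> Re (F w)) at_top"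
proof -
  \<comment> \<open>The strip is cut down to half-width below \<open>2 * pi\<close>, which keeps the other zeros \<open>w + 2 * pi * \<i> * n\<close> of \<open>exp z - exp w\<close> outside.\<close>
  define b' where "b' = min b (3 * pi / 2)"
  have b': "pi < b'" "b' < 2 * pi" "b' \<le> b" using \<open>pi < b\<close> pi_gt_zero
    by (auto simp: b'_def min_less_iff_disj)
  define S where "S = {z. \<bar>Im z\<bar> < b'}"
  define f where "f z = F z * exp z / (exp z - exp (of_real w))" for z :: complex
  define u where "u x = Im (F (Complex x pi)) * (exp x / (exp x + exp w))" for x
  have S_eq: "S = {z. Im z < b'} \<inter> {z. Im z > - b'}" by (auto simp: S_def)
  have S: "open S" "convex S"
    unfolding S_eq
    by (auto intro!: open_Int convex_Int open_halfspace_Im_lt open_halfspace_Im_gt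
        convex_halfspace_Im_lt convex_halfspace_Im_gt)
  have holoS: "F holomorphic_on S" by (rule holomorphic_on_subset[OF holo]) (use b' in \<open>auto simp: S_def\<close>)
  have exp_eq: "z = of_real w" if "exp z = exp (of_real w)" "z \<in> S" for z
  proof -
    obtain n where n: "z = of_real w + of_int (2 * n) * of_real pi * \<i>"
      using \<open>exp z = exp (of_real w)\<close> unfolding exp_eq by auto
    then have "\<bar>of_int (2 * n) * pi\<bar> < 2 * pi" using \<open>z \<in> S\<close> b' by (simp add: S_def)
    then have "\<bar>of_int n :: real\<bar> < 1" using pi_gt_zero by (simp add: abs_mult)
    then have "n = 0" by linarith
    then show ?thesis using n by simp
  qed
  have holof: "f holomorphic_on S - {of_real w}"
    unfolding f_def using exp_eq
    by (intro holomorphic_intros holomorphic_on_subset[OF holoS]) auto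
  have wS: "of_real w \<in> S" using b' pi_gt_zero by (simp add: S_def)
  have res: "residue f (of_real w) = F (of_real w)"
  proof (rule residue_simple'[OF \<open>open S\<close> wS holof])
    have 1: "((\<lambda>z. (exp z - exp (of_real w)) / (z - of_real w)) \<longlongrightarrow> exp (of_real w :: complex)) (at (of_real w))"
      using DERIV_exp[of "of_real w :: complex"] by (simp add: has_field_derivative_iff)
    have 2: "(F \<longlongrightarrow> F (of_real w)) (at (of_real w))"
      using holomorphic_on_imp_continuous_on[OF holoS] S wS
      by (simp add: continuous_on_eq_continuous_at isCont_def)
    have 3: "((\<lambda>z. exp z) \<longlongrightarrow> exp (of_real w :: complex)) (at (of_real w))"
      by (intro tendsto_intros)
    from tendsto_divide[OF tendsto_mult[OF 2 3] 1]
    show "((\<lambda>z. f z * (z - of_real w)) \<longlongrightarrow> F (of_real w)) (at (of_real w))"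
      by (simp add: f_def)
  qed
  have key: "norm (of_real (integral {-R..R} (\<lambda>x. - u x / pi)) - F (of_real w)) \<le> Br R * (exp R / (exp R - exp w)) + Bl R / (exp w - exp (- R))"
    if R: "\<bar>w\<bar> < R" and br: "\<forall>z. Re z = R \<and> \<bar>Im z\<bar> \<le> pi \<longrightarrow> norm (F z) \<le> Br R"
      and bl: "\<forall>z. Re z = - R \<and> \<bar>Im z\<bar> \<le> pi \<longrightarrow> norm (F z * exp z) \<le> Bl R" for R
  proof -
    have "0 < R" using R by simp
    let ?a1 = "Complex (- R) (- pi)" and ?a2 = "Complex R (- pi)" and ?a3 = "Complex R pi" and ?a4 = "Complex (- R) pi"
    let ?A = "contour_integral (linepath ?a1 ?a2) f" and ?B = "contour_integral (linepath ?a2 ?a3) f"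
    let ?C = "contour_integral (linepath ?a3 ?a4) f" and ?D = "contour_integral (linepath ?a4 ?a1) f"
    have img: "path_image (rectpath ?a1 ?a3) \<subseteq> S - {of_real w}"
      using R b' pi_gt_zero \<open>0 < R\<close> by (auto simp: path_image_rectpath S_def)
    then have img': "closed_segment ?a1 ?a2 \<subseteq> S - {of_real w}" "closed_segment ?a2 ?a3 \<subseteq> S - {of_real w}"
       "closed_segment ?a3 ?a4 \<subseteq> S - {of_real w}" "closed_segment ?a4 ?a1 \<subseteq> S - {of_real w}"
      by (auto simp: rectpath_def Let_def path_image_join)
    have cint: "f contour_integrable_on linepath p q" if "closed_segment p q \<subseteq> S - {of_real w}" for p q
      using holomorphic_on_imp_continuous_on[OF holomorphic_on_subset[OF holof that]]
      by (rule contour_integrable_continuous_linepath)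
    have "contour_integral (rectpath ?a1 ?a3) f = 2 * pi * \<i> * (\<Sum>p\<in>{of_real w}. winding_number (rectpath ?a1 ?a3) p * residue f p)"
    proof (rule Residue_theorem)
      show "connected S" using S by (simp add: convex_connected)
      have "cbox ?a1 ?a3 \<subseteq> S" using b' by (auto simp: S_def in_cbox_complex_iff)
      then show "\<forall>z. z \<notin> S \<longrightarrow> winding_number (rectpath ?a1 ?a3) z = 0"
        using \<open>0 < R\<close> pi_gt_zero by (intro allI impI winding_number_rectpath_outside) auto
    qed (use S holof img in auto)
    moreover have "winding_number (rectpath ?a1 ?a3) (of_real w) = 1"
      using R by (intro winding_number_rectpath) (auto simp: in_box_complex_iff)
    moreover have "contour_integral (rectpath ?a1 ?a3) f = ?A + (?B + (?C + ?D))"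
      using cint[OF img'(1)] cint[OF img'(2)] cint[OF img'(3)] cint[OF img'(4)]
      by (simp add: rectpath_def Let_def contour_integrable_joinI)
    ultimately have sum: "?A + (?B + (?C + ?D)) = 2 * pi * \<i> * F (of_real w)" by (simp add: res)
    have top: "f (Complex x pi) = F (Complex x pi) * of_real (exp x / (exp x + exp w))" for x
    proof -
      have "exp (Complex x pi) = - of_real (exp x)" by (simp add: exp_eq_polar Complex_eq exp_add exp_of_real)
      then have "f (Complex x pi) = F (Complex x pi) * (- of_real (exp x)) / - (of_real (exp x) + of_real (exp w))"
        unfolding f_def by (simp add: exp_of_real)
      also have "\<dots> = F (Complex x pi) * of_real (exp x) / (of_real (exp x) + of_real (exp w))"
        unfolding mult_minus_right minus_divide_divide ..
      finally show ?thesis by simp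
    qed
    have cnj_Complex: "Complex x (- pi) = cnj (Complex x pi)" for x by (simp add: complex_eq_iff)
    have bot: "f (Complex x (- pi)) = cnj (f (Complex x pi))" for x
      using cnj[of "Complex x pi"] \<open>pi < b\<close> unfolding f_def
      by (simp add: exp_cnj cnj_Complex)
    have ci: "(\<lambda>x. f (Complex x pi)) integrable_on {-R..R}"
    proof (rule integrable_continuous_real)
      have "continuous_on {-R..R} (f \<circ> (\<lambda>x. Complex x pi))"
      proof (rule continuous_on_compose)
        show "continuous_on ((\<lambda>x. Complex x pi) ` {- R..R}) f"
          by (rule holomorphic_on_imp_continuous_on[OF holomorphic_on_subset[OF holof]])
             (use b' pi_gt_zero in \<open>auto simp: S_def complex_eq_iff\<close>)
      qed (simp add: Complex_eq, intro continuous_intros)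
      then show "continuous_on {-R..R} (\<lambda>x. f (Complex x pi))" by (simp add: o_def)
    qed
    let ?I = "integral {-R..R} (\<lambda>x. f (Complex x pi))"
    have "?A = cnj ?I"
      using \<open>0 < R\<close> by (simp add: contour_integral_linepath_same_Im bot integral_cnj)
    moreover have "?C = - ?I"
    proof -
      have "?C = - contour_integral (linepath ?a4 ?a3) f"
        by (rule contour_integral_reverse_linepath)
           (use holomorphic_on_imp_continuous_on[OF holomorphic_on_subset[OF holof img'(3)]]
            in \<open>simp add: closed_segment_commute\<close>)
      then show ?thesis using \<open>0 < R\<close> by (simp add: contour_integral_linepath_same_Im)
    qed
    ultimately have "?A + ?C = - 2 * \<i> * of_real (Im ?I)" by (simp add: complex_eq_iff)
    also have "Im ?I = integral {-R..R} u"
      using integral_linear[OF ci bounded_linear_Im] by (simp add: o_def top u_def[abs_def])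
    also have "- 2 * \<i> * of_real (integral {-R..R} u) = 2 * pi * \<i> * of_real (integral {-R..R} (\<lambda>x. - u x / pi))"
      by (simp add: field_simps)
    finally have AC: "?A + ?C = 2 * pi * \<i> * of_real (integral {-R..R} (\<lambda>x. - u x / pi))" .
    have "?A + ?C + (?B + ?D) = 2 * pi * \<i> * F (of_real w)" using sum by (simp add: add_ac)
    then have "2 * pi * \<i> * (of_real (integral {-R..R} (\<lambda>x. - u x / pi)) - F (of_real w)) = - (?B + ?D)"
      unfolding AC right_diff_distrib by (metis add_diff_cancel_left' minus_diff_eq)
    from arg_cong[OF this, of norm]
    have "2 * pi * norm (of_real (integral {-R..R} (\<lambda>x. - u x / pi)) - F (of_real w)) = norm (?B + ?D)"
      unfolding norm_mult norm_minus_cancel by simp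
    also have "\<dots> \<le> norm ?B + norm ?D" by (rule norm_triangle_ineq)
    also have "norm ?B \<le> Br R * (exp R / (exp R - exp w)) * norm (?a3 - ?a2)"
    proof (rule contour_integral_bound_linepath[OF cint[OF img'(2)]])
      have "0 \<le> Br R" using order.trans[OF norm_ge_zero br[rule_format, of "of_real R"]] by simp
      then show "0 \<le> Br R * (exp R / (exp R - exp w))" using R by simp
      fix z assume "z \<in> closed_segment ?a2 ?a3"
      then have z: "Re z = R" "\<bar>Im z\<bar> \<le> pi"
        using pi_gt_zero by (auto simp: closed_segment_same_Re closed_segment_eq_real_ivl split: if_splits)
      have "exp R - exp w \<le> norm (exp z - exp (of_real w))"
        using norm_triangle_ineq2[of "exp z" "exp (of_real w)"] z by simp
      then have "norm (F z) * (norm (exp z) / norm (exp z - exp (of_real w))) \<le> Br R * (exp R / (exp R - exp w))"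
        using z br R \<open>0 \<le> Br R\<close> by (intro mult_mono frac_le) auto
      then show "norm (f z) \<le> Br R * (exp R / (exp R - exp w))"
        by (simp add: f_def norm_mult norm_divide)
    qed
    also have "norm ?D \<le> Bl R / (exp w - exp (- R)) * norm (?a1 - ?a4)"
    proof (rule contour_integral_bound_linepath[OF cint[OF img'(4)]])
      have "0 \<le> Bl R" using order.trans[OF norm_ge_zero bl[rule_format, of "of_real (- R)"]] by simp
      then show "0 \<le> Bl R / (exp w - exp (- R))" using R by simp
      fix z assume "z \<in> closed_segment ?a4 ?a1"
      then have z: "Re z = - R" "\<bar>Im z\<bar> \<le> pi"
        using pi_gt_zero by (auto simp: closed_segment_same_Re closed_segment_eq_real_ivl split: if_splits)
      have "exp w - exp (- R) \<le> norm (exp z - exp (of_real w))"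
        using norm_triangle_ineq2[of "exp (of_real w)" "exp z"] z by (simp add: norm_minus_commute)
      then have "norm (F z * exp z) / norm (exp z - exp (of_real w)) \<le> Bl R / (exp w - exp (- R))"
        using z bl R \<open>0 \<le> Bl R\<close> by (intro frac_le) auto
      then show "norm (f z) \<le> Bl R / (exp w - exp (- R))"
        by (simp add: f_def norm_divide)
    qed
    also have "?a3 - ?a2 = \<i> * of_real (2 * pi)" by (simp add: complex_eq_iff)
    also have "?a1 - ?a4 = - \<i> * of_real (2 * pi)" by (simp add: complex_eq_iff)
    also have "norm (\<i> * of_real (2 * pi)) = 2 * pi" by (simp add: norm_mult)
    also have "norm (- \<i> * of_real (2 * pi)) = 2 * pi" by (simp add: norm_mult)
    finally have "2 * pi * norm (of_real (integral {-R..R} (\<lambda>x. - u x / pi)) - F (of_real w))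
        \<le> 2 * pi * (Br R * (exp R / (exp R - exp w)) + Bl R / (exp w - exp (- R)))"
      by (simp only: distrib_left mult.commute[of _ "2 * pi"])
    then show ?thesis by (rule mult_left_le_imp_le) simp
  qed
  have "((\<lambda>R. of_real (integral {-R..R} (\<lambda>x. - u x / pi)) - F (of_real w)) \<longlongrightarrow> 0) at_top"
  proof (rule Lim_null_comparison)
    show "\<forall>\<^sub>F R in at_top. norm (of_real (integral {-R..R} (\<lambda>x. - u x / pi)) - F (of_real w))
        \<le> Br R * (exp R / (exp R - exp w)) + Bl R / (exp w - exp (- R))"
      using right(2) left(2) eventually_gt_at_top[of "\<bar>w\<bar>"]
      by eventually_elim (rule key)
    have "((\<lambda>R. exp R / (exp R - exp w)) \<longlongrightarrow> 1) at_top" "((\<lambda>R. exp w - exp (- R)) \<longlongrightarrow> exp w) at_top"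
      by real_asymp+
    from tendsto_add[OF tendsto_mult[OF right(1) this(1)] tendsto_divide[OF left(1) this(2)]]
    show "((\<lambda>R. Br R * (exp R / (exp R - exp w)) + Bl R / (exp w - exp (- R))) \<longlongrightarrow> 0) at_top" by simp
  qed
  from tendsto_Re[OF this[THEN LIM_zero_cancel]]
  have "((\<lambda>R. integral {-R..R} (\<lambda>x. - u x / pi)) \<longlongrightarrow> Re (F w)) at_top" by simp
  moreover have "- u x / pi = - Im (F (Complex x pi)) / pi * (exp x / (exp x + exp w))" for x
    by (simp add: u_def)
  ultimately show ?thesis by (simp only:)
qed

section \<open>The quotient in the logarithmic variable\<close>

text \<open>
  With \<open>\<gamma> = 1 - \<alpha>\<close> this is the analytic continuation of \<open>\<Phi> s / s\<close> in the variable \<open>z = ln s\<close>. The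
  principal branch is the right one on the strip \<open>\<bar>Im z\<bar> < pi / \<gamma>\<close>, which contains the closed strip
  \<open>\<bar>Im z\<bar> \<le> pi\<close> because \<open>\<gamma> < 1\<close>.
\<close>

definition Phi_quot :: "real \<Rightarrow> real \<Rightarrow> complex \<Rightarrow> complex" where
  "Phi_quot \<gamma> \<beta> z = exp (- of_real \<gamma> * z) * (1 + of_real \<gamma> * exp (- of_real \<gamma> * z)) powr (- of_real \<beta>)"

lemma Phi_quot_of_real:
  assumes "0 < \<alpha>" "\<alpha> < 1"
  shows "Phi_quot (1 - \<alpha>) \<beta> (of_real w) = of_real (Phi \<alpha> \<beta> (exp w) / exp w)"
proof -
  have "Phi_quot (1 - \<alpha>) \<beta> (of_real w)
      = of_real (exp (- (1 - \<alpha>) * w)) * of_real (1 + (1 - \<alpha>) * exp (- (1 - \<alpha>) * w)) powr (of_real (- \<beta>))"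
  proof -
    have "exp (- of_real (1 - \<alpha>) * of_real w) = (of_real (exp (- (1 - \<alpha>) * w)) :: complex)"
      by (metis exp_of_real of_real_minus of_real_mult)
    then show ?thesis by (simp only: Phi_quot_def of_real_add of_real_1 of_real_mult of_real_minus)
  qed
  also have "\<dots> = of_real (exp (- (1 - \<alpha>) * w) * (1 + (1 - \<alpha>) * exp (- (1 - \<alpha>) * w)) powr (- \<beta>))"
    using assms by (subst powr_of_real) (auto intro!: add_nonneg_nonneg)
  also have "exp (- (1 - \<alpha>) * w) = exp w powr \<alpha> / exp w"
    by (simp add: powr_def left_diff_distrib exp_diff exp_minus divide_inverse)
  also have "exp w powr \<alpha> / exp w = exp w powr (\<alpha> - 1)"
    by (simp add: powr_diff)
  finally show ?thesis
    by (simp add: Phi_def powr_diff)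
qed

text \<open>
  A point \<open>1 + p\<close> is on the cut only if \<open>p\<close> is a negative real number, whereas the argument of
  \<open>exp (- \<gamma> * z)\<close> is strictly between \<open>- pi\<close> and \<open>pi\<close>.
\<close>

lemma one_plus_exp_notin_nonpos_Reals:
  fixes \<gamma> c :: real
  assumes "0 < c" and "\<bar>\<gamma> * Im z\<bar> < pi"
  shows "1 + of_real c * exp (- of_real \<gamma> * z) \<notin> \<real>\<^sub>\<le>\<^sub>0"
proof
  assume "1 + of_real c * exp (- of_real \<gamma> * z) \<in> \<real>\<^sub>\<le>\<^sub>0"
  then have re: "1 + c * (exp (- \<gamma> * Re z) * cos (\<gamma> * Im z)) \<le> 0" and "sin (\<gamma> * Im z) = 0"
    using \<open>0 < c\<close> by (auto simp: complex_nonpos_Reals_iff Re_exp Im_exp)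
  then have "\<gamma> * Im z = 0" using assms(2) sin_eq_0_pi[of "\<gamma> * Im z"] by (metis abs_less_iff minus_less_iff)
  then have "0 < 1 + c * (exp (- \<gamma> * Re z) * cos (\<gamma> * Im z))"
    using \<open>0 < c\<close> by (auto intro: add_pos_pos)
  with re show False by simp
qed

lemma Phi_quot_base_notin_nonpos_Reals:
  assumes "0 < \<gamma>" "\<bar>Im z\<bar> < pi / \<gamma>"
  shows "1 + of_real \<gamma> * exp (- of_real \<gamma> * z) \<notin> \<real>\<^sub>\<le>\<^sub>0"
proof (rule one_plus_exp_notin_nonpos_Reals[OF assms(1)])
  have "\<gamma> * \<bar>Im z\<bar> < \<gamma> * (pi / \<gamma>)" by (rule mult_strict_left_mono[OF assms(2,1)])
  also have "\<gamma> * (pi / \<gamma>) = pi" using assms(1) by simp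
  also have "\<gamma> * \<bar>Im z\<bar> = \<bar>\<gamma> * Im z\<bar>" using assms(1) by (simp add: abs_mult)
  finally show "\<bar>\<gamma> * Im z\<bar> < pi" .
qed

lemma holomorphic_Phi_quot:
  assumes "0 < \<gamma>" shows "Phi_quot \<gamma> \<beta> holomorphic_on {z. \<bar>Im z\<bar> < pi / \<gamma>}"
  unfolding Phi_quot_def
  using Phi_quot_base_notin_nonpos_Reals[OF assms] by (intro holomorphic_intros) simp

lemma Phi_quot_cnj:
  assumes "0 < \<gamma>" "\<bar>Im z\<bar> < pi / \<gamma>"
  shows "Phi_quot \<gamma> \<beta> (cnj z) = cnj (Phi_quot \<gamma> \<beta> z)"
proof -
  define \<zeta> where "\<zeta> = 1 + of_real \<gamma> * exp (- of_real \<gamma> * z)"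
  have "\<zeta> \<notin> \<real>\<^sub>\<le>\<^sub>0"
    unfolding \<zeta>_def by (rule Phi_quot_base_notin_nonpos_Reals[OF assms])
  then have "cnj (\<zeta> powr (- of_real \<beta>)) = cnj \<zeta> powr cnj (- of_real \<beta>)"
    unfolding complex_nonpos_Reals_iff by (intro cnj_powr) linarith
  moreover have e: "cnj (exp (- of_real \<gamma> * z)) = exp (- of_real \<gamma> * cnj z)"
    unfolding exp_cnj by simp
  moreover have "cnj \<zeta> = 1 + of_real \<gamma> * exp (- of_real \<gamma> * cnj z)"
    unfolding \<zeta>_def complex_cnj_add complex_cnj_mult e by simp
  ultimately show ?thesis
    unfolding Phi_quot_def \<zeta>_def[symmetric] complex_cnj_mult by simp
qed

lemma norm_Phi_quot:
  "norm (Phi_quot \<gamma> \<beta> z) = exp (- \<gamma> * Re z) * norm (1 + of_real \<gamma> * exp (- of_real \<gamma> * z)) powr (- \<beta>)"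
proof -
  have "- complex_of_real \<beta> = of_real (- \<beta>)" by simp
  then show ?thesis unfolding Phi_quot_def by (simp only: norm_mult norm_exp norm_powr_real_powr' Reals_of_real Re_complex_of_real) simp
qed

text \<open>
  Far to the right the base is close to \<open>1\<close>, far to the left it is large. In both cases it stays away
  from \<open>0\<close>, where the negative power would blow up.
\<close>

lemma norm_Phi_quot_right:
  assumes "0 \<le> \<beta>" "0 < \<gamma>" "\<gamma> * exp (- \<gamma> * Re z) \<le> 1 / 2"
  shows "norm (Phi_quot \<gamma> \<beta> z) \<le> exp (- \<gamma> * Re z) * 2 powr \<beta>"
proof -
  have "1 / 2 \<le> 1 - norm (of_real \<gamma> * exp (- of_real \<gamma> * z))"
    using assms by (simp add: norm_mult)
  also have "\<dots> \<le> norm (1 + of_real \<gamma> * exp (- of_real \<gamma> * z))"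
    using norm_diff_ineq[of 1 "of_real \<gamma> * exp (- of_real \<gamma> * z)"] by simp
  finally have "norm (1 + of_real \<gamma> * exp (- of_real \<gamma> * z)) powr (- \<beta>) \<le> (1 / 2) powr (- \<beta>)"
    using assms by (intro powr_mono2') auto
  also have "(1 / 2) powr (- \<beta>) = 2 powr \<beta>"
    by (simp add: powr_minus powr_divide)
  finally show ?thesis unfolding norm_Phi_quot by (intro mult_left_mono) auto
qed

lemma norm_Phi_quot_left:
  assumes "0 \<le> \<beta>" "0 < \<gamma>" "2 \<le> \<gamma> * exp (- \<gamma> * Re z)"
  shows "norm (Phi_quot \<gamma> \<beta> z) \<le> exp (- \<gamma> * Re z)"
proof -
  have "1 \<le> norm (of_real \<gamma> * exp (- of_real \<gamma> * z)) - 1"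
    using assms by (simp add: norm_mult)
  also have "\<dots> \<le> norm (1 + of_real \<gamma> * exp (- of_real \<gamma> * z))"
    using norm_diff_ineq[of "of_real \<gamma> * exp (- of_real \<gamma> * z)" 1] by (simp add: add.commute)
  finally have "norm (1 + of_real \<gamma> * exp (- of_real \<gamma> * z)) powr (- \<beta>) \<le> 1 powr (- \<beta>)"
    using assms by (intro powr_mono2') auto
  then show ?thesis unfolding norm_Phi_quot by (simp add: mult_left_le)
qed

text \<open>
  Here \<open>\<beta> \<le> 1\<close> is used. On the upper side of the slit \<open>exp (- \<gamma> * z)\<close> has argument \<open>- \<gamma> * pi\<close>. Adding \<open>1\<close>
  to a positive multiple of it turns the argument towards \<open>0\<close>, so the base \<open>\<zeta>\<close> has argument \<open>\<phi>\<close> with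
  \<open>- \<gamma> * pi < \<phi> < 0\<close>. The quotient then has argument \<open>- (\<gamma> * pi + \<beta> * \<phi>)\<close>. For \<open>0 \<le> \<beta> \<le> 1\<close> it lies in
  \<open>[- pi, 0]\<close>.
\<close>

lemma Im_Phi_quot_nonpos:
  assumes \<gamma>: "0 < \<gamma>" "\<gamma> < 1" and \<beta>: "0 \<le> \<beta>" "\<beta> \<le> 1"
  shows "Im (Phi_quot \<gamma> \<beta> (Complex x pi)) \<le> 0"
proof -
  define y where "y = \<gamma> * exp (- \<gamma> * x)"
  define \<zeta> where "\<zeta> = 1 + of_real y * cis (- \<gamma> * pi)"
  define \<phi> where "\<phi> = Im (Ln \<zeta>)"
  have "y > 0" using \<gamma> by (simp add: y_def)
  have sin: "0 < sin (\<gamma> * pi)" using \<gamma> pi_gt_zero by (intro sin_gt_zero) auto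
  have e: "exp (- of_real \<gamma> * Complex x pi) = of_real (exp (- \<gamma> * x)) * cis (- \<gamma> * pi)"
    by (simp add: exp_eq_polar)
  have "Im \<zeta> < 0" using \<open>y > 0\<close> sin by (simp add: \<zeta>_def)
  then have "\<zeta> \<noteq> 0" by auto
  have \<phi>: "- pi < \<phi>" "\<phi> \<le> pi" using mpi_less_Im_Ln Im_Ln_le_pi \<open>\<zeta> \<noteq> 0\<close> by (auto simp: \<phi>_def)
  have polar: "\<zeta> = of_real (norm \<zeta>) * cis \<phi>"
    using exp_eq_polar[of "Ln \<zeta>"] \<open>\<zeta> \<noteq> 0\<close> by (simp add: \<phi>_def Re_Ln)
  have "norm \<zeta> * sin \<phi> < 0" using \<open>Im \<zeta> < 0\<close> by (subst (asm) polar) simp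
  then have "\<phi> < 0" using sin_ge_zero[of \<phi>] \<phi> by (smt (verit) mult_nonneg_nonneg norm_ge_zero)
  \<comment> \<open>Rotating by \<open>\<gamma> * pi\<close> shows that the argument of \<open>\<zeta>\<close> exceeds \<open>- \<gamma> * pi\<close>.\<close>
  have "\<zeta> * cis (\<gamma> * pi) = cis (\<gamma> * pi) + of_real y"
    by (simp add: \<zeta>_def distrib_right mult.assoc cis_mult)
  then have "0 < Im (\<zeta> * cis (\<gamma> * pi))" using sin by simp
  also have "\<zeta> * cis (\<gamma> * pi) = of_real (norm \<zeta>) * cis (\<phi> + \<gamma> * pi)"
    by (subst polar) (simp add: mult.assoc cis_mult)
  finally have "0 < norm \<zeta> * sin (\<phi> + \<gamma> * pi)" by simp
  then have "0 < sin (\<phi> + \<gamma> * pi)" using \<open>\<zeta> \<noteq> 0\<close> by (simp add: zero_less_mult_iff)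
  have "0 < \<phi> + \<gamma> * pi"
  proof (rule ccontr)
    assume "\<not> 0 < \<phi> + \<gamma> * pi"
    moreover have "0 < \<gamma> * pi" using \<gamma> by simp
    ultimately have "0 \<le> sin (- (\<phi> + \<gamma> * pi))" using \<phi> by (intro sin_ge_zero) auto
    then show False using \<open>0 < sin (\<phi> + \<gamma> * pi)\<close> by (simp only: sin_minus)
  qed
  moreover have "\<phi> \<le> \<beta> * \<phi>" "\<beta> * \<phi> \<le> 0"
    using \<open>\<phi> < 0\<close> \<beta> by (auto simp: mult_le_0_iff mult_le_cancel_right2)
  moreover have "\<gamma> * pi < pi" using \<gamma> by simp
  ultimately have s: "0 \<le> sin (\<gamma> * pi + \<beta> * \<phi>)" by (intro sin_ge_zero) linarith+
  have p: "\<zeta> powr (- of_real \<beta>) = of_real (exp (- \<beta> * Re (Ln \<zeta>))) * cis (- \<beta> * \<phi>)"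
    using \<open>\<zeta> \<noteq> 0\<close> by (simp add: powr_def exp_eq_polar \<phi>_def)
  have "Phi_quot \<gamma> \<beta> (Complex x pi) = of_real (exp (- \<gamma> * x)) * cis (- \<gamma> * pi) * \<zeta> powr (- of_real \<beta>)"
    unfolding Phi_quot_def e by (simp add: \<zeta>_def y_def mult.assoc)
  also have "\<dots> = of_real (exp (- \<gamma> * x) * exp (- \<beta> * Re (Ln \<zeta>))) * cis (- (\<gamma> * pi + \<beta> * \<phi>))"
  proof -
    have "cis (- \<gamma> * pi) * cis (- \<beta> * \<phi>) = cis (- (\<gamma> * pi + \<beta> * \<phi>))" by (simp add: cis_mult)
    then show ?thesis unfolding p by (simp add: mult.assoc mult.left_commute)
  qed
  finally have "Im (Phi_quot \<gamma> \<beta> (Complex x pi))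
      = exp (- \<gamma> * x) * exp (- \<beta> * Re (Ln \<zeta>)) * - sin (\<gamma> * pi + \<beta> * \<phi>)"
    by (simp only: cis.sel sin_minus Im_complex_of_real Re_complex_of_real times_complex.sel)
  then show ?thesis using s by (simp add: mult_nonneg_nonneg)
qed

section \<open>The characterisation\<close>

text \<open>
  The Cauchy formula on the strip, multiplied by \<open>s = exp w\<close>, represents \<open>\<Phi> s\<close> as a mixture of the functions
  \<open>s / (s + exp x)\<close>. The weight is \<open>k x * exp x\<close> with the boundary density \<open>k\<close>, which is nonnegative by
  \<open>Im_Phi_quot_nonpos\<close>. The integrals over \<open>[- R, R]\<close> therefore increase, and their limit is the full
  Lebesgue integral.
\<close>

theorem complete_bernstein_Phi:
  assumes \<alpha>: "0 < \<alpha>" "\<alpha> < 1" and \<beta>: "0 \<le> \<beta>" "\<beta> \<le> 1"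
  shows "complete_bernstein_function (Phi \<alpha> \<beta>)"
proof -
  define \<gamma> where "\<gamma> = 1 - \<alpha>"
  have \<gamma>: "0 < \<gamma>" "\<gamma> < 1" using \<alpha> by (auto simp: \<gamma>_def)
  define k where "k x = - Im (Phi_quot \<gamma> \<beta> (Complex x pi)) / pi" for x
  have strip: "pi < pi / \<gamma>" using \<gamma> by (simp add: field_simps)
  have k_nonneg: "0 \<le> k x" for x
    unfolding k_def using Im_Phi_quot_nonpos[OF \<gamma> \<beta>, of x] by (simp add: divide_nonpos_pos)
  have k_cont: "continuous_on UNIV k"
  proof -
    have "continuous_on UNIV (Phi_quot \<gamma> \<beta> \<circ> (\<lambda>x. Complex x pi))"
    proof (rule continuous_on_compose)
      show "continuous_on (range (\<lambda>x. Complex x pi)) (Phi_quot \<gamma> \<beta>)"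
        by (rule holomorphic_on_imp_continuous_on[OF holomorphic_on_subset[OF holomorphic_Phi_quot[OF \<gamma>(1)]]])
           (use strip in auto)
    qed (simp add: Complex_eq, intro continuous_intros)
    then show ?thesis unfolding k_def by (auto intro!: continuous_intros simp: o_def)
  qed
  then have [measurable]: "k \<in> borel_measurable borel" by (rule borel_measurable_continuous_onI)
  have lim: "((\<lambda>R. integral {-R..R} (\<lambda>x. k x * (exp x / (exp x + exp w)))) \<longlongrightarrow> Phi \<alpha> \<beta> (exp w) / exp w) at_top" for w
  proof -
    \<comment> \<open>\<open>?Bl\<close> combines \<open>norm (exp z) = exp (- R)\<close> with the growth \<open>exp (\<gamma> * R)\<close> of the quotient; it tends to \<open>0\<close> because \<open>\<gamma> < 1\<close>.\<close>
    let ?Br = "\<lambda>R. exp (- \<gamma> * R) * 2 powr \<beta>" and ?Bl = "\<lambda>R. exp ((\<gamma> - 1) * R)"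
    have "((\<lambda>R. integral {-R..R} (\<lambda>x. - Im (Phi_quot \<gamma> \<beta> (Complex x pi)) / pi * (exp x / (exp x + exp w))))
        \<longlongrightarrow> Re (Phi_quot \<gamma> \<beta> (of_real w))) at_top"
    proof (rule strip_cauchy_formula[OF strip holomorphic_Phi_quot[OF \<gamma>(1)] Phi_quot_cnj[OF \<gamma>(1)]])
      show "(?Br \<longlongrightarrow> 0) at_top" using \<gamma> by real_asymp
      show "(?Bl \<longlongrightarrow> 0) at_top" using \<gamma> by real_asymp
      have "((\<lambda>R. \<gamma> * exp (- \<gamma> * R)) \<longlongrightarrow> 0) at_top" using \<gamma> by real_asymp
      then have "\<forall>\<^sub>F R in at_top. \<gamma> * exp (- \<gamma> * R) < 1 / 2" by (rule order_tendstoD) simp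
      then show "\<forall>\<^sub>F R in at_top. \<forall>z. Re z = R \<and> \<bar>Im z\<bar> \<le> pi \<longrightarrow> norm (Phi_quot \<gamma> \<beta> z) \<le> ?Br R"
        by eventually_elim (use norm_Phi_quot_right[OF \<beta>(1) \<gamma>(1)] in auto)
      have "filterlim (\<lambda>R. \<gamma> * exp (\<gamma> * R)) at_top at_top" using \<gamma> by real_asymp
      then have "\<forall>\<^sub>F R in at_top. 2 \<le> \<gamma> * exp (\<gamma> * R)" by (simp add: filterlim_at_top)
      then show "\<forall>\<^sub>F R in at_top. \<forall>z. Re z = - R \<and> \<bar>Im z\<bar> \<le> pi \<longrightarrow> norm (Phi_quot \<gamma> \<beta> z * exp z) \<le> ?Bl R"
      proof eventually_elim
        case (elim R)
        show ?case
        proof (intro allI impI)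
          fix z assume z: "Re z = - R \<and> \<bar>Im z\<bar> \<le> pi"
          have "norm (Phi_quot \<gamma> \<beta> z * exp z) \<le> exp (- \<gamma> * Re z) * exp (Re z)"
            unfolding norm_mult norm_exp_eq_Re
            using elim z by (intro mult_right_mono norm_Phi_quot_left \<beta> \<gamma>) auto
          also have "\<dots> = ?Bl R" using z by (simp add: exp_add[symmetric] algebra_simps)
          finally show "norm (Phi_quot \<gamma> \<beta> z * exp z) \<le> ?Bl R" .
        qed
      qed
    qed
    then show ?thesis unfolding k_def[symmetric] by (simp add: \<gamma>_def Phi_quot_of_real \<alpha>)
  qed
  define M where "M = density lborel (\<lambda>x. ennreal (k x * exp x))"
  show ?thesis
  proof (rule complete_bernstein_function_stieltjes_integral[of M exp])
    show "sigma_finite_measure M"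
      unfolding M_def
      by (subst sigma_finite_measure.sigma_finite_iff_density_finite[OF sigma_finite_lborel]) auto
    show "(exp :: real \<Rightarrow> real) \<in> borel_measurable M" by (simp add: M_def)
    fix s :: real assume "s > 0"
    define w where "w = ln s"
    have s: "s = exp w" using \<open>s > 0\<close> by (simp add: w_def)
    let ?h = "\<lambda>x. k x * (exp x / (exp x + exp w))"
    let ?f = "\<lambda>n x. indicator {- real n..real n} x * ?h x"
    have h_nonneg: "0 \<le> ?h x" for x using k_nonneg by (simp add: add_nonneg_nonneg)
    have set_int: "set_integrable lborel {- real n..real n} ?h" for n
      by (rule borel_integrable_atLeastAtMost')
         (intro continuous_intros continuous_on_subset[OF k_cont], auto simp: add_pos_pos less_imp_neq[symmetric])
    then have int: "integrable lborel (?f n)" for n unfolding set_integrable_def by simp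
    have "integral\<^sup>L lborel (?f n) = integral {- real n..real n} ?h" for n
      using set_borel_integral_eq_integral(2)[OF set_int[of n]] by (simp add: set_lebesgue_integral_def)
    then have ilim: "(\<lambda>n. integral\<^sup>L lborel (?f n)) \<longlonglongrightarrow> Phi \<alpha> \<beta> s / s"
      using filterlim_compose[OF lim[of w] filterlim_real_sequentially] by (simp add: s)
    have mono: "mono (\<lambda>n. ?f n x)" for x
      using h_nonneg by (intro monoI mult_right_mono) (auto simp: indicator_def)
    have plim: "(\<lambda>n. ?f n x) \<longlonglongrightarrow> ?h x" for x
    proof (rule tendsto_eventually)
      show "\<forall>\<^sub>F n in sequentially. ?f n x = ?h x"
        using eventually_ge_at_top[of "nat \<lceil>\<bar>x\<bar>\<rceil>"]
        by eventually_elim (simp add: indicator_def, linarith)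
    qed
    have f_nonneg: "0 \<le> ?f n x" for n x by (intro mult_nonneg_nonneg h_nonneg) simp
    have "?h \<in> borel_measurable lborel" by measurable
    note monotone_limit = integral_monotone_convergence_nonneg[of lborel ?f ?h,
        OF int AE_I2[OF mono] AE_I2[OF f_nonneg] AE_I2[OF plim] ilim this]
    have "has_bochner_integral lborel ?h (Phi \<alpha> \<beta> s / s)" using monotone_limit unfolding has_bochner_integral_iff by blast
    from has_bochner_integral_mult_left[OF this, of s]
    have "has_bochner_integral lborel (\<lambda>x. ?h x * s) (Phi \<alpha> \<beta> s)" using \<open>s > 0\<close> by simp
    also have "(\<lambda>x. ?h x * s) = (\<lambda>x. (k x * exp x) *\<^sub>R (s / (s + exp x)))"
      by (simp add: s add.commute fun_eq_iff)
    finally show "has_bochner_integral M (\<lambda>x. s / (s + exp x)) (Phi \<alpha> \<beta> s)"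
      unfolding M_def using k_nonneg by (intro has_bochner_integral_density) auto
  qed simp
qed

theorem theorem5p1:
  fixes \<alpha> \<beta> :: real
  assumes "0 < \<alpha>" and "\<alpha> < 1" and "0 \<le> \<beta>"
  shows "((0 \<le> \<beta> \<and> \<beta> \<le> 1) \<longleftrightarrow> bernstein_function (Phi \<alpha> \<beta>)) \<and>
         (bernstein_function (Phi \<alpha> \<beta>) \<longleftrightarrow> complete_bernstein_function (Phi \<alpha> \<beta>))"
proof -
  have "complete_bernstein_function (Phi \<alpha> \<beta>)" if "\<beta> \<le> 1"
    using complete_bernstein_Phi assms that by blast
  moreover have "bernstein_function (Phi \<alpha> \<beta>)" if "complete_bernstein_function (Phi \<alpha> \<beta>)"
    using that unfolding complete_bernstein_function_def by blast
  moreover have "\<beta> \<le> 1" if "bernstein_function (Phi \<alpha> \<beta>)"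
    using not_bernstein_Phi[of \<alpha> \<beta>] assms that by force
  ultimately show ?thesis using assms by blast
qed

end
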